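(* There is a one-to-one correspondence between Lorenz braids $\mathbb{L}\in B_{p+d_p}$ with defining vector $\vec d_L=\langle d_1,\dots,d_p\rangle$ satisfying $2\le d_1\le d_2\le\dots\le d_{p-1}=d_p$ (with $p\ge2$), and triples $(t,\vec n,\vec m)$ with $t\ge 2$ an integer and $\vec n=(n_1,\dots,n_{t-1})$, $\vec m=(m_1,\dots,m_{t-1})$ vectors of non-negative integers; the correspondence sends $\mathbb{L}$ to its trip number $t$ and the vectors $\vec n,\vec m$ counting its LL and RR strands as defined in the context. Each triple $(t,\vec n,\vec m)$ determines a $t$-braid $$\mathbb{M}=(\sigma_1\cdots\sigma_{t-1})^t\ \prod_{i=1}^{t-1}(\sigma_1\sigma_2\cdots\sigma_i)^{n_i}\ \prod_{i=1}^{t-1}(\sigma_{t-1}\sigma_{t-2}\cdots\sigma_{t-i})^{m_i}.$$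
   Context: $\sigma_1,\dots,\sigma_{n-1}$ are the standard generators of the braid group $B_n$. For integers $p\ge 2$ and $2\le d_1\le\dots\le d_{p-1}=d_p$, the Lorenz braid with defining vector $\vec d_L=\langle d_1,\dots,d_p\rangle$ is the positive braid on $p+d_p$ strands in which, for $1\le i\le p$, the strand beginning at position $i$ (an overcrossing strand) ends at position $i+d_i$; the $d_p$ strands beginning at positions $p+1,\dots,p+d_p$ (undercrossing strands) fill the remaining end positions in order-preserving fashion; any two strands cross at most once, and every crossing is an overcrossing strand passing over an undercrossing strand. Positions $1,\dots,p$ are called left (L) and positions $p+1,\dots,p+d_p$ right (R). A strand has type LL, LR, RL or RR according to whether its beginning position (first letter) and end position (second letter) lie in L or R. The trip number is $t=\#\{i : 1\le i\le p,\ i+d_i>p\}$; strand $j$ has type LL iff $1\le j\le p-t$. For a strand beginning at position $j$ put $\overline{j}=p+d_p+1-j$. For an undercrossing strand $j$ (so $1\le\overline{j}\le d_p$), $\overline{d}_{\overline{j}}$ denotes the number of overcrossing strands that it crosses, i.e. $\overline{d}_q=\#\{i: d_i\ge d_p+1-q\}$; strand $j$ has type RR iff $1\le\overline{j}\le d_p-t$. For $1\le i\le t-1$ define $$n_i=\#\{\text{strands } j \text{ of type LL with } d_j=i+1\},\qquad m_i=\#\{\text{strands } j \text{ of type RR with } \overline{d}_{\overline{j}}=i+1\}.$$ *)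

theory Defs
  imports "HOL-Algebra.Group"
begin

text \<open>
  Artin's presentation. The letter \<open>(i, True)\<close> stands for \<open>\<sigma>\<^sub>i\<close> and \<open>(i, False)\<close> for its inverse.
  A word is read from left to right along the braid, from the beginning positions to the end
  positions, and \<open>\<sigma>\<^sub>i\<close> is the crossing in which the strand at position \<open>i\<close> passes over the strand
  at position \<open>i + 1\<close>.
\<close>

type_synonym braid_word = "(nat \<times> bool) list"

definition braid_words :: "nat \<Rightarrow> braid_word set" where
  "braid_words n = lists ({1..<n} \<times> UNIV)"

inductive braid_eq :: "nat \<Rightarrow> braid_word \<Rightarrow> braid_word \<Rightarrow> bool" for n where
  refl: "w \<in> braid_words n \<Longrightarrow> braid_eq n w w"
| sym: "braid_eq n u v \<Longrightarrow> braid_eq n v u"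
| trans: "braid_eq n u v \<Longrightarrow> braid_eq n v w \<Longrightarrow> braid_eq n u w"
| append: "braid_eq n u u' \<Longrightarrow> braid_eq n v v' \<Longrightarrow> braid_eq n (u @ v) (u' @ v')"
| cancel: "1 \<le> i \<Longrightarrow> i < n \<Longrightarrow> braid_eq n [(i, e), (i, \<not> e)] []"
| far: "1 \<le> i \<Longrightarrow> i + 2 \<le> j \<Longrightarrow> j < n \<Longrightarrow>
    braid_eq n [(i, True), (j, True)] [(j, True), (i, True)]"
| braid: "1 \<le> i \<Longrightarrow> i + 1 < n \<Longrightarrow>
    braid_eq n [(i, True), (i + 1, True), (i, True)] [(i + 1, True), (i, True), (i + 1, True)]"

definition braid_class :: "nat \<Rightarrow> braid_word \<Rightarrow> braid_word set" where
  "braid_class n w = {v. braid_eq n w v}"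

definition braid_group :: "nat \<Rightarrow> braid_word set monoid" where
  "braid_group n =
    \<lparr>carrier = braid_class n ` braid_words n,
     monoid.mult = (\<lambda>A B. {w. \<exists>a\<in>A. \<exists>b\<in>B. braid_eq n (a @ b) w}),
     one = braid_class n []\<rparr>"

definition sigma :: "nat \<Rightarrow> nat \<Rightarrow> braid_word set" where
  "sigma n i = braid_class n [(i, True)]"

lemma braid_eq_words: "braid_eq n u v \<Longrightarrow> u \<in> braid_words n \<and> v \<in> braid_words n"
  by (induction rule: braid_eq.induct) (auto simp: braid_words_def)

lemma braid_class_eq_iff:
  assumes "u \<in> braid_words n"
  shows "braid_class n u = braid_class n v \<longleftrightarrow> braid_eq n u v"
  unfolding braid_class_def using assms
  by (auto intro: braid_eq.refl braid_eq.sym braid_eq.trans)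

lemma braid_mult_class:
  assumes "u \<in> braid_words n" "v \<in> braid_words n"
  shows "braid_class n u \<otimes>\<^bsub>braid_group n\<^esub> braid_class n v = braid_class n (u @ v)"
  using assms unfolding braid_group_def braid_class_def
  by (auto intro: braid_eq.refl braid_eq.append braid_eq.trans)

lemma braid_word_inverse:
  assumes "w \<in> braid_words n"
  shows "\<exists>v\<in>braid_words n. braid_eq n (v @ w) []"
  using assms
proof (induction w)
  case Nil
  then show ?case by (intro bexI[of _ "[]"]) (auto intro: braid_eq.refl simp: braid_words_def)
next
  case (Cons x w)
  obtain i e where x: "x = (i, e)" by (cases x)
  have w: "w \<in> braid_words n" and i: "1 \<le> i" "i < n"
    using Cons.prems x by (auto simp: braid_words_def)
  obtain v where v: "v \<in> braid_words n" "braid_eq n (v @ w) []"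
    using Cons.IH w by blast
  have "braid_eq n [(i, \<not> e), (i, e)] []"
    using braid_eq.cancel[OF i, of "\<not> e"] by simp
  then have "braid_eq n ([(i, \<not> e), (i, e)] @ w) ([] @ w)"
    by (rule braid_eq.append[OF _ braid_eq.refl[OF w]])
  then have "braid_eq n (v @ ([(i, \<not> e), (i, e)] @ w)) (v @ ([] @ w))"
    by (rule braid_eq.append[OF braid_eq.refl[OF v(1)]])
  then have "braid_eq n ((v @ [(i, \<not> e)]) @ (x # w)) []"
    using v(2) x by (auto intro: braid_eq.trans)
  moreover have "v @ [(i, \<not> e)] \<in> braid_words n"
    using v(1) i by (auto simp: braid_words_def)
  ultimately show ?case by blast
qed

lemma append_braid_words:
  "u \<in> braid_words n \<Longrightarrow> v \<in> braid_words n \<Longrightarrow> u @ v \<in> braid_words n"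
  by (auto simp: braid_words_def)

lemma braid_group_group: "group (braid_group n)"
proof (rule groupI)
  have carr: "carrier (braid_group n) = braid_class n ` braid_words n"
    and one: "\<one>\<^bsub>braid_group n\<^esub> = braid_class n []"
    by (simp_all add: braid_group_def)
  have nil: "[] \<in> braid_words n"
    by (simp add: braid_words_def)
  show "\<one>\<^bsub>braid_group n\<^esub> \<in> carrier (braid_group n)"
    using nil by (simp add: carr one)
  fix x assume "x \<in> carrier (braid_group n)"
  then obtain u where u: "u \<in> braid_words n" "x = braid_class n u"
    by (auto simp: carr)
  show "\<one>\<^bsub>braid_group n\<^esub> \<otimes>\<^bsub>braid_group n\<^esub> x = x"
    using u nil by (simp add: one braid_mult_class)
  obtain u' where u': "u' \<in> braid_words n" "braid_eq n (u' @ u) []"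
    using braid_word_inverse u(1) by blast
  then have "braid_class n u' \<otimes>\<^bsub>braid_group n\<^esub> x = \<one>\<^bsub>braid_group n\<^esub>"
    using u u' by (simp add: one braid_mult_class append_braid_words braid_class_eq_iff)
  then show "\<exists>y\<in>carrier (braid_group n). y \<otimes>\<^bsub>braid_group n\<^esub> x = \<one>\<^bsub>braid_group n\<^esub>"
    using u'(1) by (auto simp: carr)
  fix y assume "y \<in> carrier (braid_group n)"
  then obtain v where v: "v \<in> braid_words n" "y = braid_class n v"
    by (auto simp: carr)
  show "x \<otimes>\<^bsub>braid_group n\<^esub> y \<in> carrier (braid_group n)"
    using u v by (simp add: carr braid_mult_class append_braid_words)
  fix z assume "z \<in> carrier (braid_group n)"
  then obtain w where w: "w \<in> braid_words n" "z = braid_class n w"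
    by (auto simp: carr)
  show "x \<otimes>\<^bsub>braid_group n\<^esub> y \<otimes>\<^bsub>braid_group n\<^esub> z =
        x \<otimes>\<^bsub>braid_group n\<^esub> (y \<otimes>\<^bsub>braid_group n\<^esub> z)"
    using u v w by (simp add: braid_mult_class append_braid_words)
qed

text \<open>
  An arrangement maps each position to the strand (named by its beginning position) that currently
  occupies it. A positive word is a list of generator indices. Crossings are listed as pairs
  (overcrossing strand, undercrossing strand).
\<close>

definition swap_at :: "nat \<Rightarrow> (nat \<Rightarrow> nat) \<Rightarrow> (nat \<Rightarrow> nat)" where
  "swap_at i a = a(i := a (Suc i), Suc i := a i)"

fun final_arrangement :: "(nat \<Rightarrow> nat) \<Rightarrow> nat list \<Rightarrow> (nat \<Rightarrow> nat)" where
  "final_arrangement a [] = a"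
| "final_arrangement a (i # w) = final_arrangement (swap_at i a) w"

fun crossings :: "(nat \<Rightarrow> nat) \<Rightarrow> nat list \<Rightarrow> (nat \<times> nat) list" where
  "crossings a [] = []"
| "crossings a (i # w) = (a i, a (Suc i)) # crossings (swap_at i a) w"

definition positive_word :: "nat list \<Rightarrow> braid_word" where
  "positive_word w = map (\<lambda>i. (i, True)) w"

text \<open>The list \<open>ds\<close> is the defining vector; positions are counted from 1 and list entries from 0.\<close>

definition num_over :: "nat list \<Rightarrow> nat" where
  "num_over ds = length ds"

definition d_at :: "nat list \<Rightarrow> nat \<Rightarrow> nat" where
  "d_at ds i = ds ! (i - 1)"

definition num_under :: "nat list \<Rightarrow> nat" where
  "num_under ds = d_at ds (num_over ds)"

definition num_strands :: "nat list \<Rightarrow> nat" where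
  "num_strands ds = num_over ds + num_under ds"

definition defining_vector :: "nat list \<Rightarrow> bool" where
  "defining_vector ds \<longleftrightarrow>
     2 \<le> num_over ds \<and> 2 \<le> d_at ds 1 \<and>
     (\<forall>i j. 1 \<le> i \<longrightarrow> i \<le> j \<longrightarrow> j \<le> num_over ds \<longrightarrow> d_at ds i \<le> d_at ds j) \<and>
     d_at ds (num_over ds - 1) = d_at ds (num_over ds)"

definition over_strands :: "nat list \<Rightarrow> nat set" where
  "over_strands ds = {1..num_over ds}"

definition under_strands :: "nat list \<Rightarrow> nat set" where
  "under_strands ds = {num_over ds + 1..num_strands ds}"

definition strand_end :: "nat list \<Rightarrow> nat \<Rightarrow> nat" where
  "strand_end ds j =
     (if j \<le> num_over ds then j + d_at ds j
      else sorted_list_of_set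
             ({1..num_strands ds} - (\<lambda>i. i + d_at ds i) ` over_strands ds) ! (j - num_over ds - 1))"

definition is_lorenz_word :: "nat list \<Rightarrow> nat list \<Rightarrow> bool" where
  "is_lorenz_word ds w \<longleftrightarrow>
     set w \<subseteq> {1..<num_strands ds} \<and>
     (\<forall>j\<in>{1..num_strands ds}. final_arrangement id w (strand_end ds j) = j) \<and>
     distinct (map (\<lambda>(a, b). {a, b}) (crossings id w)) \<and>
     set (crossings id w) \<subseteq> over_strands ds \<times> under_strands ds"

definition is_lorenz_braid :: "nat list \<Rightarrow> braid_word set \<Rightarrow> bool" where
  "is_lorenz_braid ds \<beta> \<longleftrightarrow>
     (\<exists>w. is_lorenz_word ds w \<and> \<beta> = braid_class (num_strands ds) (positive_word w))"

text \<open>A braid is paired with its number of strands, so braids of different groups stay distinct.\<close>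

definition lorenz_braids :: "(nat \<times> braid_word set) set" where
  "lorenz_braids =
     {(N, \<beta>). \<exists>ds. defining_vector ds \<and> N = num_strands ds \<and> is_lorenz_braid ds \<beta>}"

definition trip_number :: "nat list \<Rightarrow> nat" where
  "trip_number ds = card {i \<in> over_strands ds. i + d_at ds i > num_over ds}"

text \<open>Positions \<open>1, \<dots>, p\<close> are left and \<open>p + 1, \<dots>, p + d\<^sub>p\<close> are right, whatever the strand.\<close>

definition LL_strands :: "nat list \<Rightarrow> nat set" where
  "LL_strands ds = {j \<in> {1..num_over ds}. strand_end ds j \<in> {1..num_over ds}}"

definition RR_strands :: "nat list \<Rightarrow> nat set" where
  "RR_strands ds =
     {j \<in> {num_over ds + 1..num_strands ds}.
        strand_end ds j \<in> {num_over ds + 1..num_strands ds}}"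

definition strand_bar :: "nat list \<Rightarrow> nat \<Rightarrow> nat" where
  "strand_bar ds j = num_strands ds + 1 - j"

text \<open>
  The number of overcrossing strands crossed by the undercrossing strand \<open>j\<close> with
  \<open>strand_bar ds j = q\<close>: that is the undercrossing strand number \<open>d\<^sub>p + 1 - q\<close> from the left, and the
  overcrossing strand \<open>i\<close> crosses precisely the first \<open>d\<^sub>i\<close> undercrossing strands.
\<close>

definition d_bar :: "nat list \<Rightarrow> nat \<Rightarrow> nat" where
  "d_bar ds q = card {i \<in> over_strands ds. d_at ds i \<ge> num_under ds + 1 - q}"

definition LL_counts :: "nat list \<Rightarrow> nat list" where
  "LL_counts ds =
     map (\<lambda>i. card {j \<in> LL_strands ds. d_at ds j = i + 1}) [1..<trip_number ds]"

definition RR_counts :: "nat list \<Rightarrow> nat list" where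
  "RR_counts ds =
     map (\<lambda>i. card {j \<in> RR_strands ds. d_bar ds (strand_bar ds j) = i + 1}) [1..<trip_number ds]"

definition lorenz_triples :: "(nat \<times> nat list \<times> nat list) set" where
  "lorenz_triples = {(t, n, m). 2 \<le> t \<and> length n = t - 1 \<and> length m = t - 1}"

definition ordered_prod :: "('a, 'b) monoid_scheme \<Rightarrow> 'a list \<Rightarrow> 'a" where
  "ordered_prod G xs = foldr (\<lambda>x y. x \<otimes>\<^bsub>G\<^esub> y) xs \<one>\<^bsub>G\<^esub>"

definition t_braid :: "nat \<Rightarrow> nat list \<Rightarrow> nat list \<Rightarrow> braid_word set" where
  "t_braid t n m =
     (let B = braid_group t; \<sigma> = sigma t in
        ordered_prod B (map \<sigma> [1..<t]) [^]\<^bsub>B\<^esub> t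
        \<otimes>\<^bsub>B\<^esub> ordered_prod B
              (map (\<lambda>i. ordered_prod B (map \<sigma> [1..<i + 1]) [^]\<^bsub>B\<^esub> (n ! (i - 1))) [1..<t])
        \<otimes>\<^bsub>B\<^esub> ordered_prod B
              (map (\<lambda>i. ordered_prod B (map (\<lambda>k. \<sigma> (t - k)) [1..<i + 1]) [^]\<^bsub>B\<^esub> (m ! (i - 1)))
                [1..<t]))"

end

theory Submission
  imports Defs "HOL-Combinatorics.Transposition" "HOL-Library.Multiset"
begin

text \<open>
  The correspondence is a composite of two bijections, both starting from the set of defining
  vectors: one leads to the Lorenz braids (\<open>lorenz_braid_of_bij\<close>), the other to the triples
  (\<open>counts_bij\<close>).

  Vectors and braids. In a Lorenz word only the pattern of overcrossing and undercrossing strands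
  matters, and a letter \<open>\<sigma>\<^sub>i\<close> slides an overcrossing strand from position \<open>i\<close> to a free position
  \<open>i + 1\<close>. So Lorenz words are sequences of slides of a set of positions, from \<open>{1..p}\<close> to the set
  of the \<open>i + d\<^sub>i\<close>. One set can be slid to another of the same size precisely if it has, among
  the first \<open>k\<close> positions, at least as many elements, for every \<open>k\<close>; this yields a Lorenz word
  for each vector. Two different slides available at the same moment are at distance at least 2,
  so their letters commute, and the same criterion lets the two resulting words be continued to a
  common one: any two Lorenz words of a vector are equal up to far commutations
  (\<open>slides_unique\<close>). Conversely the braid determines its permutation. The last overcrossing
  strand is the one that ends at the last position, so the permutation determines \<open>p\<close>, and then
  \<open>d\<^sub>i\<close> is the displacement of strand \<open>i\<close>.

  Vectors and triples. Read the defining vector backwards as the rows of a Young diagram. Since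
  \<open>i + d\<^sub>i > p\<close> says that row \<open>p + 1 - i\<close> is at least as long as its number, the trip number \<open>t\<close>
  is the side of the Durfee square, the largest square that fits in the diagram. The LL strands
  are the rows below the square, and they have lengths between 2 and \<open>t\<close>; the RR strands are the
  columns to its right, whose heights lie between 2 and \<open>t\<close> because the first two rows are equal.
  The vectors \<open>n\<close> and \<open>m\<close> are the multiplicities of these lengths and heights. A diagram is
  determined by its Durfee square and the two partitions attached to it, and every choice of
  multiplicities occurs.
\<close>

section \<open>Sliding sets of positions\<close>

text \<open>
  The effect of \<open>\<sigma>\<^sub>i\<close> on the positions of the overcrossing strands.
\<close>

definition slide :: "nat \<Rightarrow> nat set \<Rightarrow> nat set" where
  "slide i S = insert (Suc i) (S - {i})"

inductive slides :: "nat \<Rightarrow> nat set \<Rightarrow> nat list \<Rightarrow> nat set \<Rightarrow> bool" for N where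
  Nil: "slides N S [] S"
| Cons: "1 \<le> i \<Longrightarrow> i < N \<Longrightarrow> i \<in> S \<Longrightarrow> Suc i \<notin> S \<Longrightarrow> slides N (slide i S) w T \<Longrightarrow> slides N S (i # w) T"

inductive_cases slides_NilE: "slides N S [] T"
inductive_cases slides_ConsE: "slides N S (i # w) T"

text \<open>
  The height function orders the sets of a given size: each slide lowers it at one place.
\<close>

definition height :: "nat set \<Rightarrow> nat \<Rightarrow> nat" where
  "height S k = card (S \<inter> {..k})"

lemma height_Suc: "height S (Suc k) = height S k + (if Suc k \<in> S then 1 else 0)"
  by (simp add: height_def atMost_Suc Int_insert_right)

lemma height_mono: "k \<le> l \<Longrightarrow> height S k \<le> height S l"
  unfolding height_def by (intro card_mono) auto

lemma height_all: "S \<subseteq> {1..N} \<Longrightarrow> height S N = card S"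
  unfolding height_def by (rule arg_cong[of _ _ card]) auto

lemma slide_height:
  assumes "i \<in> S" "Suc i \<notin> S"
  shows "height S k = height (slide i S) k + (if k = i then 1 else 0)"
proof (induction k)
  case 0
  have "height (slide 0 S) 0 = 0" "height S 0 = (if 0 \<in> S then 1 else 0)" for S
    by (auto simp: height_def slide_def)
  moreover have "height (slide i S) 0 = height S 0" if "i \<noteq> 0"
    using that by (auto simp: height_def slide_def intro!: arg_cong[of _ _ card])
  ultimately show ?case using assms by auto
next
  case (Suc k)
  then show ?case using assms
    by (auto simp: height_Suc slide_def split: if_splits)
qed

lemma slide_subset: "S \<subseteq> {1..N} \<Longrightarrow> i < N \<Longrightarrow> slide i S \<subseteq> {1..N}"
  by (auto simp: slide_def)

lemma slide_card:
  assumes "finite S" "i \<in> S" "Suc i \<notin> S"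
  shows "card (slide i S) = card S"
  using assms by (simp add: slide_def card.insert_remove) (metis One_nat_def card_Suc_Diff1 card_Diff_singleton)

lemma slide_sum:
  assumes "finite S" "i \<in> S" "Suc i \<notin> S"
  shows "\<Sum>(slide i S) = Suc (\<Sum>S)"
  using assms by (simp add: slide_def sum.insert_remove sum.remove[of S i])

text \<open>
  The sum of the positions grows by 1 with each slide. Hence all slide words between two given
  sets have the same length, and an induction on the length can compare two such words.
\<close>

lemma slides_invariants:
  assumes "slides N S w T" "S \<subseteq> {1..N}"
  shows "T \<subseteq> {1..N} \<and> card T = card S \<and> \<Sum>T = \<Sum>S + length w \<and> (\<forall>k. height T k \<le> height S k)"
  using assms
proof induction
  case (Nil S)
  then show ?case by simp
next
  case (Cons i S w T)
  have "finite S" using Cons.prems finite_subset by blast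
  then show ?case
    using Cons slide_subset[OF Cons.prems Cons.hyps(2)] slide_card[of S i] slide_sum[of S i]
    by (auto simp: slide_height[OF Cons.hyps(3,4)] intro: trans_le_add1 le_SucI)
qed

text \<open>
  Let \<open>m\<close> be the last place where the height of \<open>S\<close> exceeds that of \<open>T\<close>. Position \<open>m + 1\<close> is
  free, as otherwise the excess would persist there. Going back from \<open>m\<close> to the last element \<open>i\<close> of
  \<open>S\<close>, the height of \<open>S\<close> stays constant and that of \<open>T\<close> cannot grow, so the excess is still
  positive at \<open>i\<close>, and sliding \<open>i\<close> keeps \<open>S\<close> above \<open>T\<close>.
\<close>

lemma exists_slide:
  assumes S: "S \<subseteq> {1..N}" and T: "T \<subseteq> {1..N}" and card: "card S = card T"
    and dom: "\<And>k. height T k \<le> height S k" and ne: "S \<noteq> T"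
  obtains i where "1 \<le> i" "i < N" "i \<in> S" "Suc i \<notin> S" "height T i < height S i"
proof -
  have "\<exists>k\<le>N. height T k < height S k"
  proof (rule ccontr)
    assume "\<not> ?thesis"
    then have eq: "height T k = height S k" if "k \<le> N" for k
      using dom[of k] that by force
    have "(Suc k \<in> S) = (Suc k \<in> T)" if "Suc k \<le> N" for k
      using eq[of k] eq[of "Suc k"] that by (auto simp: height_Suc split: if_splits)
    then have "(x \<in> S) = (x \<in> T)" for x
      using S T by (cases x; cases "x \<le> N") auto
    then show False using ne by blast
  qed
  then have fin: "finite {k. k \<le> N \<and> height T k < height S k}" "{k. k \<le> N \<and> height T k < height S k} \<noteq> {}"
    by auto
  define m where "m = Max {k. k \<le> N \<and> height T k < height S k}"
  have m: "m \<le> N" "height T m < height S m" using Max_in[OF fin] by (auto simp: m_def)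
  have max: "k \<le> m" if "k \<le> N" "height T k < height S k" for k
    using Max_ge[OF fin(1)] that by (auto simp: m_def)
  have "m \<noteq> N" using m S T card by (auto simp: height_all)
  then have mN: "m < N" using m by simp
  have Sm: "Suc m \<notin> S"
  proof
    assume "Suc m \<in> S"
    then have "height T (Suc m) < height S (Suc m)" using m by (simp add: height_Suc)
    then show False using max[of "Suc m"] mN by simp
  qed
  have "S \<inter> {..m} \<noteq> {}" using m by (auto simp: height_def)
  then have i: "Max (S \<inter> {..m}) \<in> S \<inter> {..m}" by (intro Max_in) auto
  define i where "i = Max (S \<inter> {..m})"
  have iS: "i \<in> S" "i \<le> m" using i by (auto simp: i_def)
  have imax: "x \<le> i" if "x \<in> S" "x \<le> m" for x using that by (auto simp: i_def)
  have "S \<inter> {..i} = S \<inter> {..m}" using imax iS by auto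
  then have "height S i = height S m" by (simp add: height_def)
  moreover have "height T i \<le> height T m" using iS by (intro height_mono)
  ultimately have "height T i < height S i" using m by simp
  moreover have "Suc i \<notin> S" using Sm imax[of "Suc i"] iS by (cases "i = m") auto
  ultimately show thesis using that[of i] iS S mN by auto
qed

lemma slides_exist:
  assumes "S \<subseteq> {1..N}" "T \<subseteq> {1..N}" "card S = card T" "\<And>k. height T k \<le> height S k"
  shows "\<exists>w. slides N S w T"
  using assms
proof (induction "\<Sum>{1..N} - \<Sum>S" arbitrary: S rule: less_induct)
  case less
  show ?case
  proof (cases "S = T")
    case True
    then show ?thesis using slides.Nil by blast
  next
    case False
    obtain i where i: "1 \<le> i" "i < N" "i \<in> S" "Suc i \<notin> S" "height T i < height S i"
      using exists_slide[OF less.prems False] by blast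
    have fin: "finite S" using less.prems(1) finite_subset by blast
    have sub: "slide i S \<subseteq> {1..N}" using slide_subset less.prems(1) i by blast
    have "\<Sum>(slide i S) \<le> \<Sum>{1..N}" by (rule sum_mono2[OF _ sub]) auto
    then have "\<Sum>{1..N} - \<Sum>(slide i S) < \<Sum>{1..N} - \<Sum>S"
      using slide_sum[OF fin i(3,4)] by simp
    moreover have "height T k \<le> height (slide i S) k" for k
      using less.prems(4)[of k] slide_height[OF i(3,4), of k] i(5) by (auto split: if_splits)
    moreover have "card (slide i S) = card T"
      using slide_card[OF fin i(3,4)] less.prems(3) by simp
    ultimately obtain w where "slides N (slide i S) w T"
      using less.hyps[OF _ sub less.prems(2)] by blast
    then show ?thesis using slides.Cons i by blast
  qed
qed

lemma positive_word_Cons: "positive_word (i # w) = [(i, True)] @ positive_word w"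
  by (simp add: positive_word_def)

lemma slides_words: "slides N S w T \<Longrightarrow> set w \<subseteq> {1..<N}"
  by (induction rule: slides.induct) auto

lemma positive_word_in: "set w \<subseteq> {1..<N} \<Longrightarrow> positive_word w \<in> braid_words N"
  by (auto simp: positive_word_def braid_words_def)

lemma braid_eq_Cons:
  assumes "braid_eq N (positive_word u) (positive_word v)" "1 \<le> i" "i < N"
  shows "braid_eq N (positive_word (i # u)) (positive_word (i # v))"
  unfolding positive_word_Cons
  by (rule braid_eq.append[OF braid_eq.refl assms(1)]) (use assms in \<open>auto simp: braid_words_def\<close>)

lemma braid_eq_far:
  assumes "set u \<subseteq> {1..<N}" "1 \<le> i" "i < N" "1 \<le> j" "j < N" "i + 2 \<le> j \<or> j + 2 \<le> i"
  shows "braid_eq N (positive_word (i # j # u)) (positive_word (j # i # u))"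
proof -
  have "braid_eq N [(i, True), (j, True)] [(j, True), (i, True)]"
    using assms braid_eq.far braid_eq.sym by meson
  from braid_eq.append[OF this braid_eq.refl[OF positive_word_in[OF assms(1)]]]
  show ?thesis by (simp add: positive_word_def)
qed

lemma slide_commute:
  assumes "i \<noteq> j" "i \<in> S" "j \<in> S" "Suc i \<notin> S" "Suc j \<notin> S"
  shows "slide j (slide i S) = slide i (slide j S)"
  using assms by (auto simp: slide_def)

text \<open>
  The diamond argument. If the two words begin with different slides \<open>i\<close> and \<open>j\<close>, both may be
  performed, in either order. The height function of the resulting set is still above that of \<open>T\<close>,
  because it is lowered at two different places and each place is accounted for by one of the two
  words. So some \<open>u\<close> completes it, and by induction the two words represent the same braids as
  \<open>i # j # u\<close> and \<open>j # i # u\<close>.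
\<close>

lemma slides_unique:
  assumes "slides N S w T" "slides N S v T" "S \<subseteq> {1..N}"
  shows "braid_eq N (positive_word w) (positive_word v)"
  using assms
proof (induction "length w" arbitrary: w v S rule: less_induct)
  case less
  have len: "length v = length w"
    using slides_invariants[OF less.prems(1,3)] slides_invariants[OF less.prems(2,3)] by linarith
  show ?case
  proof (cases w)
    case Nil
    then show ?thesis using len by (auto intro!: braid_eq.refl positive_word_in)
  next
    case (Cons i w')
    then obtain j v' where v: "v = j # v'" using len by (cases v) auto
    have i: "1 \<le> i" "i < N" "i \<in> S" "Suc i \<notin> S" and w': "slides N (slide i S) w' T"
      using less.prems(1) Cons by (auto elim: slides_ConsE)
    have j: "1 \<le> j" "j < N" "j \<in> S" "Suc j \<notin> S" and v': "slides N (slide j S) v' T"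
      using less.prems(2) v by (auto elim: slides_ConsE)
    have sub: "slide i S \<subseteq> {1..N}" "slide j S \<subseteq> {1..N}"
      using slide_subset less.prems(3) i j by auto
    show ?thesis
    proof (cases "i = j")
      case True
      then show ?thesis using less.hyps[OF _ w' _ sub(1), of v'] v' Cons v i braid_eq_Cons by auto
    next
      case False
      have ij: "j \<in> slide i S" "Suc j \<notin> slide i S" "i \<in> slide j S" "Suc i \<notin> slide j S"
        using False i j by (auto simp: slide_def)
      have far: "i + 2 \<le> j \<or> j + 2 \<le> i"
        using False i j by (metis Suc_leI add_2_eq_Suc' le_neq_implies_less nat_neq_iff)
      let ?U = "slide j (slide i S)"
      note ci = slides_invariants[OF w' sub(1)] and cj = slides_invariants[OF v' sub(2)]
      have fin: "finite (slide i S)" using sub(1) finite_subset by blast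
      have "height T k \<le> height ?U k" for k
      proof -
        have "height T k \<le> height (slide i S) k" "height T k \<le> height (slide j S) k"
          using ci cj by auto
        then show ?thesis
          using slide_height[OF i(3,4), of k] slide_height[OF j(3,4), of k]
            slide_height[OF ij(1,2), of k] False by (auto split: if_splits)
      qed
      moreover have "card ?U = card T" using slide_card[OF fin ij(1,2)] ci by simp
      moreover have "?U \<subseteq> {1..N}" using slide_subset sub j by blast
      moreover have "T \<subseteq> {1..N}" using ci by blast
      \<comment> \<open>the common continuation that closes the diamond\<close>
      ultimately obtain u where u: "slides N ?U u T" using slides_exist by blast
      have u1: "slides N (slide i S) (j # u) T" using slides.Cons[OF j(1,2) ij(1,2) u] .
      have u2: "slides N (slide j S) (i # u) T"
        using slides.Cons[OF i(1,2) ij(3,4)] u slide_commute[OF False i(3) j(3) i(4) j(4)] by simp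
      have "braid_eq N (positive_word w) (positive_word (i # j # u))"
        unfolding Cons by (intro braid_eq_Cons less.hyps[OF _ w' u1 sub(1)] i) (simp add: Cons)
      moreover have "braid_eq N (positive_word (j # i # u)) (positive_word v)"
        unfolding v
        by (intro braid_eq_Cons braid_eq.sym[OF less.hyps[OF _ v' u2 sub(2)]] j)
          (use len v in simp)
      ultimately show ?thesis
        using braid_eq_far[OF slides_words[OF u] i(1,2) j(1,2) far] braid_eq.trans by blast
    qed
  qed
qed

section \<open>Arrangements of strands\<close>

lemma final_arrangement_append:
  "final_arrangement a (u @ v) = final_arrangement (final_arrangement a u) v"
  by (induction u arbitrary: a) auto

text \<open>
  A letter and its inverse exchange the same two positions, so forgetting the signs turns a braid
  word into a word in the symmetric group.
\<close>

lemma braid_eq_same_permutation: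
  "braid_eq n u v \<Longrightarrow> final_arrangement a (map fst u) = final_arrangement a (map fst v)"
proof (induction arbitrary: a rule: braid_eq.induct)
  case (append u u' v v')
  then show ?case by (simp add: final_arrangement_append)
qed (auto simp: swap_at_def fun_eq_iff)

lemma final_arrangement_inj: "inj a \<Longrightarrow> inj (final_arrangement a w)"
proof (induction w arbitrary: a)
  case (Cons i w)
  have "swap_at i a = a \<circ> Transposition.transpose i (Suc i)"
    by (auto simp: swap_at_def fun_eq_iff Transposition.transpose_def)
  then have "inj (swap_at i a)" using Cons.prems by (simp add: inj_compose)
  then show ?case using Cons.IH by simp
qed simp

definition over_positions :: "nat \<Rightarrow> nat \<Rightarrow> (nat \<Rightarrow> nat) \<Rightarrow> nat set" where
  "over_positions p N a = {k \<in> {1..N}. a k \<in> {1..p}}"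

lemma over_positions_swap:
  assumes "1 \<le> i" "i < N" "i \<in> over_positions p N a" "Suc i \<notin> over_positions p N a"
  shows "over_positions p N (swap_at i a) = slide i (over_positions p N a)"
  using assms by (auto simp: over_positions_def swap_at_def slide_def)

lemma crossings_slides:
  assumes "set w \<subseteq> {1..<N}" "set (crossings a w) \<subseteq> {1..p} \<times> {p + 1..N}"
  shows "slides N (over_positions p N a) w (over_positions p N (final_arrangement a w))"
  using assms
proof (induction w arbitrary: a)
  case Nil
  then show ?case by (simp add: slides.Nil)
next
  case (Cons i w)
  have i: "1 \<le> i" "i < N" "i \<in> over_positions p N a" "Suc i \<notin> over_positions p N a"
    using Cons.prems by (auto simp: over_positions_def)
  show ?case
    using slides.Cons[OF i] Cons.IH[of "swap_at i a"] Cons.prems over_positions_swap[OF i] by auto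
qed

text \<open>
  Overcrossing strands never cross one another, and neither do undercrossing strands: the
  arrangement is a shuffle of two increasing sequences.
\<close>

definition shuffled :: "nat \<Rightarrow> nat \<Rightarrow> (nat \<Rightarrow> nat) \<Rightarrow> bool" where
  "shuffled p N a \<longleftrightarrow> (\<forall>k\<in>{1..N}. a k \<in> {1..N}) \<and>
     (\<forall>k l. 1 \<le> k \<and> k < l \<and> l \<le> N \<and> (a k \<le> p \<longleftrightarrow> a l \<le> p) \<longrightarrow> a k < a l)"

lemma shuffled_swap:
  assumes "shuffled p N a" "1 \<le> i" "i < N" "i \<in> over_positions p N a" "Suc i \<notin> over_positions p N a"
  shows "shuffled p N (swap_at i a)"
proof -
  have a: "\<And>k. 1 \<le> k \<Longrightarrow> k \<le> N \<Longrightarrow> 1 \<le> a k \<and> a k \<le> N"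
    and mono: "\<And>k l. 1 \<le> k \<Longrightarrow> k < l \<Longrightarrow> l \<le> N \<Longrightarrow> (a k \<le> p \<longleftrightarrow> a l \<le> p) \<Longrightarrow> a k < a l"
    using assms(1) by (auto simp: shuffled_def)
  have ends: "a i \<le> p" "\<not> a (Suc i) \<le> p"
    using assms a[of i] a[of "Suc i"] by (auto simp: over_positions_def)
  have "swap_at i a k < swap_at i a l"
    if kl: "1 \<le> k" "k < l" "l \<le> N" and same: "swap_at i a k \<le> p \<longleftrightarrow> swap_at i a l \<le> p" for k l
  proof -
    consider "l = i" | "k = i" "l = Suc i" | "k = i" "l > Suc i" | "k = Suc i"
      | "l = Suc i" "k < i" | "k \<notin> {i, Suc i}" "l \<notin> {i, Suc i}"
      using kl(2) by force
    then show ?thesis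
      using kl same ends mono[of k l] mono[of k "Suc i"] mono[of "Suc i" l] mono[of i l] mono[of k i]
        assms(2,3)
      by cases (auto simp: swap_at_def split: if_splits)
  qed
  moreover have "swap_at i a k \<in> {1..N}" if "k \<in> {1..N}" for k
    using a[of k] a[of i] a[of "Suc i"] assms(2,3) that by (auto simp: swap_at_def)
  ultimately show ?thesis by (auto simp: shuffled_def)
qed

text \<open>
  If only overcrossing strands pass over undercrossing ones, a strand can only pass over strands to
  its right. Once it has done so they lie to its left, which is why no pair crosses twice.
\<close>

lemma crossings_ordered:
  assumes "set (crossings a w) \<subseteq> {1..p} \<times> {p + 1..N}" "(x, y) \<in> set (crossings a w)"
  shows "\<exists>k l. k < l \<and> a k = x \<and> a l = y"
  using assms
proof (induction w arbitrary: a)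
  case (Cons i w)
  show ?case
  proof (cases "(x, y) = (a i, a (Suc i))")
    case True
    then show ?thesis by (intro exI[of _ i] exI[of _ "Suc i"]) auto
  next
    case False
    then have "(x, y) \<in> set (crossings (swap_at i a) w)" using Cons.prems by auto
    then obtain k l where kl: "k < l" "swap_at i a k = x" "swap_at i a l = y"
      using Cons.IH[of "swap_at i a"] Cons.prems by auto
    have xy: "x \<le> p" "y > p" using Cons.prems by auto
    have ends: "a i \<le> p" "a (Suc i) > p" using Cons.prems by auto
    let ?r = "Transposition.transpose i (Suc i)"
    have r: "a (?r k) = x" "a (?r l) = y"
      using kl by (auto simp: swap_at_def Transposition.transpose_def split: if_splits)
    have "\<not> (k = i \<and> l = Suc i)" using r xy ends by auto
    then have "?r k < ?r l" using kl(1) by (auto simp: Transposition.transpose_def)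
    then show ?thesis using r by blast
  qed
qed simp

text \<open>
  Starting from a shuffle, each slide is a crossing of an overcrossing strand over an undercrossing
  one, and keeps the arrangement a shuffle.
\<close>

lemma slides_arrangement:
  assumes "slides N (over_positions p N a) w T" "shuffled p N a" "inj a"
  shows "over_positions p N (final_arrangement a w) = T \<and> shuffled p N (final_arrangement a w) \<and>
    set (crossings a w) \<subseteq> {1..p} \<times> {p + 1..N} \<and> distinct (crossings a w)"
  using assms
proof (induction w arbitrary: a)
  case Nil
  then show ?case by (auto elim: slides_NilE)
next
  case (Cons i w)
  have i: "1 \<le> i" "i < N" "i \<in> over_positions p N a" "Suc i \<notin> over_positions p N a"
    and sl: "slides N (slide i (over_positions p N a)) w T"
    using Cons.prems(1) by (auto elim: slides_ConsE)
  let ?b = "swap_at i a"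
  have inj: "inj ?b" using final_arrangement_inj[OF Cons.prems(3), of "[i]"] by simp
  note IH = Cons.IH[OF _ shuffled_swap[OF Cons.prems(2) i] inj, unfolded over_positions_swap[OF i],
      OF sl]
  have "(a i, a (Suc i)) \<in> {1..p} \<times> {p + 1..N}"
    using i Cons.prems(2) by (auto simp: over_positions_def shuffled_def)
  moreover have "(a i, a (Suc i)) \<notin> set (crossings ?b w)"
  proof
    assume "(a i, a (Suc i)) \<in> set (crossings ?b w)"
    then obtain k l where kl: "k < l" "?b k = a i" "?b l = a (Suc i)"
      using crossings_ordered[of ?b w p N "a i" "a (Suc i)"] IH by blast
    have "?b (Suc i) = a i" "?b i = a (Suc i)" by (simp_all add: swap_at_def)
    then have "k = Suc i" "l = i" using kl inj by (metis injD)+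
    then show False using kl(1) by simp
  qed
  ultimately show ?case using IH by simp
qed

text \<open>
  Identifies the final arrangement from its monotonicity on each of the two classes of strands.
\<close>

lemma strict_mono_self_map:
  fixes f :: "nat \<Rightarrow> nat"
  assumes mono: "\<And>x y. a \<le> x \<Longrightarrow> x < y \<Longrightarrow> y \<le> b \<Longrightarrow> f x < f y"
    and range: "\<And>x. a \<le> x \<Longrightarrow> x \<le> b \<Longrightarrow> a \<le> f x \<and> f x \<le> b"
    and x: "a \<le> x" "x \<le> b"
  shows "f x = x"
proof -
  have up: "x \<le> f x" if "a \<le> x" "x \<le> b" for x
    using that
  proof (induction x rule: dec_induct)
    case base
    then show ?case using range by simp
  next
    case (step n)
    then show ?case using mono[of n "Suc n"] by simp
  qed
  have down: "f x \<le> x" if "x \<le> b" "a \<le> x" for x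
    using that
  proof (induction x rule: inc_induct)
    case base
    then show ?case using range by simp
  next
    case (step n)
    then show ?case using mono[of n "Suc n"] by simp
  qed
  show ?thesis using up down x by (simp add: antisym)
qed

section \<open>Lorenz words\<close>

definition over_ends :: "nat list \<Rightarrow> nat set" where
  "over_ends ds = (\<lambda>i. i + d_at ds i) ` over_strands ds"

lemma d_at_mono:
  "defining_vector ds \<Longrightarrow> 1 \<le> i \<Longrightarrow> i \<le> j \<Longrightarrow> j \<le> num_over ds \<Longrightarrow> d_at ds i \<le> d_at ds j"
  by (auto simp: defining_vector_def)

lemma d_at_ge2:
  "defining_vector ds \<Longrightarrow> 1 \<le> i \<Longrightarrow> i \<le> num_over ds \<Longrightarrow> 2 \<le> d_at ds i"
  using d_at_mono[of ds 1 i] by (metis defining_vector_def le_trans order.refl)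

lemma over_ends_subset:
  assumes "defining_vector ds"
  shows "over_ends ds \<subseteq> {1..num_strands ds}"
proof -
  have "i + d_at ds i \<le> num_strands ds" if "1 \<le> i" "i \<le> num_over ds" for i
    using d_at_mono[OF assms that(1,2) order.refl] that
    by (simp add: num_strands_def num_under_def)
  then show ?thesis by (auto simp: over_ends_def over_strands_def)
qed

lemma over_ends_card:
  assumes "defining_vector ds"
  shows "card (over_ends ds) = num_over ds"
proof -
  have "inj_on (\<lambda>i. i + d_at ds i) (over_strands ds)"
    unfolding over_strands_def
  proof (rule linorder_inj_onI)
    fix i j assume "i < j" "i \<in> {1..num_over ds}" "j \<in> {1..num_over ds}"
    then show "i + d_at ds i \<noteq> j + d_at ds j" using d_at_mono[OF assms, of i j] by simp
  qed auto
  then show ?thesis by (simp add: over_ends_def card_image over_strands_def)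
qed

lemma under_ends_card:
  assumes "defining_vector ds"
  shows "card ({1..num_strands ds} - over_ends ds) = num_under ds"
  using card_Diff_subset[OF finite_subset[OF over_ends_subset[OF assms]] over_ends_subset[OF assms]]
    over_ends_card[OF assms] by (simp add: num_strands_def)

lemma strand_end_over:
  "1 \<le> j \<Longrightarrow> j \<le> num_over ds \<Longrightarrow> strand_end ds j = j + d_at ds j \<and> strand_end ds j \<in> over_ends ds"
  by (auto simp: strand_end_def over_ends_def over_strands_def)

lemma strand_end_under:
  assumes "defining_vector ds" "num_over ds < j" "j \<le> num_strands ds"
  shows "strand_end ds j \<in> {1..num_strands ds} - over_ends ds"
proof -
  let ?C = "{1..num_strands ds} - over_ends ds"
  have "j - num_over ds - 1 < length (sorted_list_of_set ?C)"
    using assms under_ends_card[OF assms(1)] by (simp add: num_strands_def)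
  then have "sorted_list_of_set ?C ! (j - num_over ds - 1) \<in> set (sorted_list_of_set ?C)"
    by (rule nth_mem)
  then show ?thesis using assms by (simp add: strand_end_def over_ends_def)
qed

lemma strand_end_under_mono:
  assumes "defining_vector ds" "num_over ds < j" "j < k" "k \<le> num_strands ds"
  shows "strand_end ds j < strand_end ds k"
proof -
  let ?C = "{1..num_strands ds} - over_ends ds"
  have "k - num_over ds - 1 < length (sorted_list_of_set ?C)"
    using assms under_ends_card[OF assms(1)] by (simp add: num_strands_def)
  then have "sorted_list_of_set ?C ! (j - num_over ds - 1) < sorted_list_of_set ?C ! (k - num_over ds - 1)"
    using assms by (intro sorted_wrt_nth_less[OF strict_sorted_list_of_set]) auto
  then show ?thesis using assms by (simp add: strand_end_def over_ends_def)
qed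

lemma strand_end_in:
  assumes "defining_vector ds" "j \<in> {1..num_strands ds}"
  shows "strand_end ds j \<in> {1..num_strands ds}"
  using strand_end_over[of j ds] strand_end_under[OF assms(1), of j] over_ends_subset[OF assms(1)] assms(2)
  by (cases "j \<le> num_over ds") auto

lemma over_positions_id: "p \<le> N \<Longrightarrow> over_positions p N id = {1..p}"
  by (auto simp: over_positions_def)

lemma lorenz_word_slides:
  assumes ds: "defining_vector ds" and w: "is_lorenz_word ds w"
  shows "slides (num_strands ds) {1..num_over ds} w (over_ends ds)"
proof -
  let ?p = "num_over ds" and ?N = "num_strands ds" and ?f = "final_arrangement id w"
  have pN: "?p \<le> ?N" by (simp add: num_strands_def)
  have f: "?f (strand_end ds j) = j" if "j \<in> {1..?N}" for j
    using w that by (auto simp: is_lorenz_word_def)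
  have "over_positions ?p ?N ?f = over_ends ds"
  proof (intro equalityI subsetI)
    fix k assume "k \<in> over_positions ?p ?N ?f"
    then have k: "k \<in> {1..?N}" "?f k \<in> {1..?p}" by (auto simp: over_positions_def)
    then have "?f (strand_end ds (?f k)) = ?f k" using f[of "?f k"] pN by auto
    then have "strand_end ds (?f k) = k"
      using final_arrangement_inj[OF inj_on_id] by (auto dest: injD)
    then show "k \<in> over_ends ds" using strand_end_over[of "?f k" ds] k by auto
  next
    fix k assume k: "k \<in> over_ends ds"
    then obtain j where j: "1 \<le> j" "j \<le> ?p" "k = strand_end ds j"
      using strand_end_over by (auto simp: over_ends_def over_strands_def)
    then show "k \<in> over_positions ?p ?N ?f"
      using f[of j] pN k over_ends_subset[OF ds] by (auto simp: over_positions_def)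
  qed
  moreover have "slides ?N (over_positions ?p ?N id) w (over_positions ?p ?N ?f)"
    using w by (intro crossings_slides)
      (auto simp: is_lorenz_word_def over_strands_def under_strands_def)
  ultimately show ?thesis using over_positions_id[OF pN] by simp
qed

text \<open>
  Within each class, both the end position as a function of the strand and the strand as a function
  of the final position are increasing, so their composite is the identity.
\<close>

lemma slides_lorenz_word:
  assumes ds: "defining_vector ds" and w: "slides (num_strands ds) {1..num_over ds} w (over_ends ds)"
  shows "is_lorenz_word ds w"
proof -
  let ?p = "num_over ds" and ?N = "num_strands ds" and ?f = "final_arrangement id w"
  let ?C = "{1..?N} - over_ends ds"
  have pN: "?p \<le> ?N" by (simp add: num_strands_def)
  have sl: "slides ?N (over_positions ?p ?N id) w (over_ends ds)"
    using w by (simp add: over_positions_id[OF pN])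
  have "shuffled ?p ?N id" by (simp add: shuffled_def)
  from slides_arrangement[OF sl this inj_on_id]
  have ends: "over_positions ?p ?N ?f = over_ends ds" and sh: "shuffled ?p ?N ?f"
    and cr: "set (crossings id w) \<subseteq> {1..?p} \<times> {?p + 1..?N}" and dist: "distinct (crossings id w)"
    by auto
  have over: "?f k \<in> {1..?p}" if "k \<in> over_ends ds" for k
    using that unfolding ends[symmetric] by (simp add: over_positions_def)
  have under: "?f k \<in> {?p + 1..?N}" if "k \<in> ?C" for k
  proof -
    have "?f k \<in> {1..?N}" "?f k \<notin> {1..?p}"
      using that sh unfolding ends[symmetric] by (auto simp: over_positions_def shuffled_def)
    then show ?thesis by auto
  qed
  have mono: "?f k < ?f l" if "1 \<le> k" "k < l" "l \<le> ?N" "?f k \<le> ?p \<longleftrightarrow> ?f l \<le> ?p" for k l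
    using sh that by (simp add: shuffled_def)
  have end_in: "1 \<le> strand_end ds j \<and> strand_end ds j \<le> ?N" if "1 \<le> j" "j \<le> ?N" for j
    using strand_end_in[OF ds, of j] that by auto
  have "?f (strand_end ds j) = j" if j: "j \<in> {1..?N}" for j
  proof (cases "j \<le> ?p")
    case True
    show ?thesis
    proof (rule strict_mono_self_map[where f = "\<lambda>j. ?f (strand_end ds j)" and a = 1 and b = ?p])
      fix x y assume xy: "1 \<le> x" "x < y" "y \<le> ?p"
      have "strand_end ds x < strand_end ds y"
        using strand_end_over[of x ds] strand_end_over[of y ds] d_at_mono[OF ds, of x y] xy by simp
      then show "?f (strand_end ds x) < ?f (strand_end ds y)"
        using strand_end_over[of x ds] strand_end_over[of y ds] xy pN end_in[of x] end_in[of y]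
          over[of "strand_end ds x"] over[of "strand_end ds y"] by (intro mono) auto
    next
      fix x assume "1 \<le> x" "x \<le> ?p"
      then show "1 \<le> ?f (strand_end ds x) \<and> ?f (strand_end ds x) \<le> ?p"
        using strand_end_over[of x ds] over[of "strand_end ds x"] by auto
    qed (use True j in auto)
  next
    case False
    show ?thesis
    proof (rule strict_mono_self_map[where f = "\<lambda>j. ?f (strand_end ds j)" and a = "?p + 1" and b = ?N])
      fix x y assume xy: "?p + 1 \<le> x" "x < y" "y \<le> ?N"
      then show "?f (strand_end ds x) < ?f (strand_end ds y)"
        using strand_end_under_mono[OF ds, of x y] end_in[of x] end_in[of y]
          under[OF strand_end_under[OF ds, of x]] under[OF strand_end_under[OF ds, of y]]
        by (intro mono) auto
    next
      fix x assume "?p + 1 \<le> x" "x \<le> ?N"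
      then show "?p + 1 \<le> ?f (strand_end ds x) \<and> ?f (strand_end ds x) \<le> ?N"
        using under[OF strand_end_under[OF ds, of x]] by auto
    qed (use False j in auto)
  qed
  \<comment> \<open>an unordered crossing pair determines which of its strands is the overcrossing one\<close>
  moreover have "inj_on (\<lambda>(a, b). {a, b}) ({1..?p} \<times> {?p + 1..?N})"
    by (auto simp: inj_on_def doubleton_eq_iff)
  then have "inj_on (\<lambda>(a, b). {a, b}) (set (crossings id w))" using cr by (rule inj_on_subset)
  ultimately show ?thesis
    using cr dist slides_words[OF sl]
    unfolding is_lorenz_word_def over_strands_def under_strands_def distinct_map by blast
qed

text \<open>
  No set of \<open>p\<close> positive positions has more elements among the first \<open>k\<close> positions than
  \<open>{1..p}\<close>, so every such set can be reached by slides.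
\<close>

lemma lorenz_word_exists:
  assumes "defining_vector ds"
  shows "\<exists>w. is_lorenz_word ds w"
proof -
  let ?p = "num_over ds" and ?N = "num_strands ds"
  have "height (over_ends ds) k \<le> height {1..?p} k" for k
  proof (cases "k \<le> ?p")
    case True
    have "height (over_ends ds) k \<le> card {1..k}"
      unfolding height_def using over_ends_subset[OF assms] by (intro card_mono) auto
    also have "{1..k} = {1..?p} \<inter> {..k}" using True by auto
    finally show ?thesis by (simp add: height_def)
  next
    case False
    then have "{1..?p} \<inter> {..k} = {1..?p}" by auto
    then have "height {1..?p} k = card {1..?p}" by (simp only: height_def)
    then have "height {1..?p} k = ?p" by simp
    moreover have "height (over_ends ds) k \<le> card (over_ends ds)"
      unfolding height_def using finite_subset[OF over_ends_subset[OF assms]] by (intro card_mono) auto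
    ultimately show ?thesis using over_ends_card[OF assms] by linarith
  qed
  moreover have "{1..?p} \<subseteq> {1..?N}" "card {1..?p} = card (over_ends ds)"
    using over_ends_card[OF assms] by (simp_all add: num_strands_def)
  ultimately obtain w where "slides ?N {1..?p} w (over_ends ds)"
    using slides_exist[OF _ over_ends_subset[OF assms]] by blast
  then show ?thesis using slides_lorenz_word[OF assms] by blast
qed

lemma lorenz_braid_unique:
  assumes ds: "defining_vector ds" and "is_lorenz_braid ds \<beta>" "is_lorenz_braid ds \<gamma>"
  shows "\<beta> = \<gamma>"
proof -
  obtain w v where w: "is_lorenz_word ds w" "\<beta> = braid_class (num_strands ds) (positive_word w)"
    and v: "is_lorenz_word ds v" "\<gamma> = braid_class (num_strands ds) (positive_word v)"
    using assms by (auto simp: is_lorenz_braid_def)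
  have "positive_word w \<in> braid_words (num_strands ds)"
    using w(1) by (intro positive_word_in) (simp add: is_lorenz_word_def)
  moreover have "braid_eq (num_strands ds) (positive_word w) (positive_word v)"
    using slides_unique[OF lorenz_word_slides[OF ds w(1)] lorenz_word_slides[OF ds v(1)]]
    by (simp add: num_strands_def)
  ultimately show ?thesis using w(2) v(2) by (simp add: braid_class_eq_iff)
qed

text \<open>
  For both vectors the last overcrossing strand ends at the last position, so the number of
  overcrossing strands can be read off the permutation.
\<close>

lemma lorenz_braid_determines_vector:
  assumes ds: "defining_vector ds" "is_lorenz_braid ds \<beta>"
    and es: "defining_vector es" "is_lorenz_braid es \<beta>"
    and N: "num_strands ds = num_strands es"
  shows "ds = es"
proof -
  let ?N = "num_strands es"
  obtain w v where w: "is_lorenz_word ds w" "\<beta> = braid_class ?N (positive_word w)"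
    and v: "is_lorenz_word es v" "\<beta> = braid_class ?N (positive_word v)"
    using assms by (auto simp: is_lorenz_braid_def)
  have "positive_word w \<in> braid_words ?N"
    using w(1) N by (intro positive_word_in) (simp add: is_lorenz_word_def)
  then have "braid_eq ?N (positive_word w) (positive_word v)"
    using w(2) v(2) braid_class_eq_iff by blast
  from braid_eq_same_permutation[OF this, of id]
  have same: "final_arrangement id w = final_arrangement id v"
    by (simp add: positive_word_def comp_def)
  have inj: "inj (final_arrangement id v)" by (intro final_arrangement_inj inj_on_id)
  have ends: "i = j" if "strand_end ds i = strand_end es j" "i \<in> {1..?N}" "j \<in> {1..?N}" for i j
  proof -
    have "final_arrangement id v (strand_end ds i) = i" "final_arrangement id v (strand_end es j) = j"
      using w(1) v(1) that(2,3) N same by (auto simp: is_lorenz_word_def)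
    then show ?thesis using that(1) by simp
  qed
  have same_end: "strand_end ds j = strand_end es j" if "j \<in> {1..?N}" for j
  proof -
    have "final_arrangement id v (strand_end ds j) = j" "final_arrangement id v (strand_end es j) = j"
      using w(1) v(1) that N same by (auto simp: is_lorenz_word_def)
    then show ?thesis using injD[OF inj] by metis
  qed
  \<comment> \<open>both numbers name the strand that ends at the last position\<close>
  have p: "num_over ds = num_over es"
  proof (rule ends)
    have "1 \<le> num_over ds" "1 \<le> num_over es" using ds es by (auto simp: defining_vector_def)
    then show "strand_end ds (num_over ds) = strand_end es (num_over es)"
      using N by (simp add: strand_end_def num_strands_def num_under_def)
    show "num_over ds \<in> {1..?N}" "num_over es \<in> {1..?N}"
      using \<open>1 \<le> num_over ds\<close> \<open>1 \<le> num_over es\<close> N by (auto simp: num_strands_def)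
  qed
  show ?thesis
  proof (rule nth_equalityI)
    show "length ds = length es" using p by (simp add: num_over_def)
    fix i assume "i < length ds"
    then show "ds ! i = es ! i"
      using same_end[of "Suc i"] p by (simp add: strand_end_def num_over_def d_at_def num_strands_def)
  qed
qed

section \<open>The Young diagram of a defining vector\<close>

text \<open>
  Both the trip number and the heights of the columns are sizes of upper sets of overcrossing
  strands, and this turns comparisons with them into conditions on a single row.
\<close>

lemma upper_set_card:
  fixes A :: "nat set"
  assumes "A \<subseteq> {1..p}" "\<And>x y. x \<in> A \<Longrightarrow> x \<le> y \<Longrightarrow> y \<le> p \<Longrightarrow> y \<in> A" "1 \<le> r" "r \<le> p"
  shows "r \<le> card A \<longleftrightarrow> p + 1 - r \<in> A"
proof
  assume "r \<le> card A"
  show "p + 1 - r \<in> A"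
  proof (rule ccontr)
    assume "p + 1 - r \<notin> A"
    then have "x \<in> {p + 2 - r..p}" if "x \<in> A" for x
      using assms(1) assms(2)[OF that, of "p + 1 - r"] that assms(3) by fastforce
    then have "A \<subseteq> {p + 2 - r..p}" by blast
    then have "card A \<le> card {p + 2 - r..p}" by (intro card_mono) auto
    then show False using \<open>r \<le> card A\<close> assms(3,4) by simp
  qed
next
  assume "p + 1 - r \<in> A"
  then have "{p + 1 - r..p} \<subseteq> A" using assms(2) by auto
  moreover have "finite A" using assms(1) finite_subset by blast
  ultimately have "card {p + 1 - r..p} \<le> card A" by (intro card_mono)
  then show "r \<le> card A" using assms(3,4) by simp
qed

text \<open>
  Overcrossing strands counted from the right, so that the rows of the Young diagram decrease.
\<close>

definition row :: "nat list \<Rightarrow> nat \<Rightarrow> nat" where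
  "row ds r = d_at ds (num_over ds + 1 - r)"

lemma row_antimono:
  "defining_vector ds \<Longrightarrow> 1 \<le> r \<Longrightarrow> r \<le> s \<Longrightarrow> s \<le> num_over ds \<Longrightarrow> row ds s \<le> row ds r"
  unfolding row_def by (intro d_at_mono) auto

lemma row_1: "row ds 1 = num_under ds"
  by (simp add: row_def num_under_def)

lemma row_2: "defining_vector ds \<Longrightarrow> row ds 2 = num_under ds"
  by (simp add: row_def num_under_def defining_vector_def numeral_2_eq_2)

lemma trip_number_le: "trip_number ds \<le> num_over ds"
proof -
  have "trip_number ds \<le> card {1..num_over ds}"
    unfolding trip_number_def over_strands_def by (intro card_mono) auto
  then show ?thesis by simp
qed

text \<open>
  The strand of row \<open>r\<close> ends on the right iff the diagram contains the cell \<open>(r, r)\<close>, so the trip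
  number is the side of the Durfee square.
\<close>

lemma le_trip_number_iff:
  assumes "defining_vector ds" "1 \<le> r" "r \<le> num_over ds"
  shows "r \<le> trip_number ds \<longleftrightarrow> r \<le> row ds r"
proof -
  let ?A = "{i \<in> over_strands ds. i + d_at ds i > num_over ds}"
  have "r \<le> card ?A \<longleftrightarrow> num_over ds + 1 - r \<in> ?A"
  proof (rule upper_set_card)
    fix x y assume "x \<in> ?A" "x \<le> y" "y \<le> num_over ds"
    then show "y \<in> ?A" using d_at_mono[OF assms(1), of x y] by (auto simp: over_strands_def)
  qed (use assms in \<open>auto simp: over_strands_def\<close>)
  also have "\<dots> \<longleftrightarrow> r \<le> row ds r" using assms by (auto simp: over_strands_def row_def)
  finally show ?thesis by (simp add: trip_number_def)
qed

lemma trip_number_ge2: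
  assumes "defining_vector ds"
  shows "2 \<le> trip_number ds"
proof -
  have "2 \<le> num_over ds" using assms by (simp add: defining_vector_def)
  then show ?thesis
    using le_trip_number_iff[OF assms, of 2] row_2[OF assms] d_at_ge2[OF assms, of "num_over ds"]
    by (simp add: num_under_def)
qed

lemma long_row:
  assumes "defining_vector ds" "1 \<le> r" "r \<le> trip_number ds"
  shows "trip_number ds \<le> row ds r"
  using le_trip_number_iff[OF assms(1), of "trip_number ds"] row_antimono[OF assms(1-3)]
    trip_number_le[of ds] assms by simp

lemma short_row:
  assumes "defining_vector ds" "trip_number ds < r" "r \<le> num_over ds"
  shows "row ds r \<le> trip_number ds"
  using le_trip_number_iff[OF assms(1), of "trip_number ds + 1"] assms
    row_antimono[OF assms(1), of "trip_number ds + 1" r] by simp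

lemma strand_crosses_middle_iff:
  assumes "defining_vector ds" "1 \<le> j" "j \<le> num_over ds"
  shows "num_over ds < j + d_at ds j \<longleftrightarrow> num_over ds - trip_number ds < j"
proof -
  have "num_over ds + 1 - (num_over ds + 1 - j) = j" using assms by simp
  then have "row ds (num_over ds + 1 - j) = d_at ds j" by (simp add: row_def)
  then show ?thesis
    using le_trip_number_iff[OF assms(1), of "num_over ds + 1 - j"] assms(2,3) trip_number_le[of ds]
    by (simp; linarith)
qed

lemma LL_strands_eq:
  assumes "defining_vector ds"
  shows "LL_strands ds = {1..num_over ds - trip_number ds}"
proof (rule Set.set_eqI)
  fix j
  show "j \<in> LL_strands ds \<longleftrightarrow> j \<in> {1..num_over ds - trip_number ds}"
  proof (cases "1 \<le> j \<and> j \<le> num_over ds")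
    case True
    then have "num_over ds < strand_end ds j \<longleftrightarrow> num_over ds - trip_number ds < j" "1 \<le> strand_end ds j"
      using strand_crosses_middle_iff[OF assms, of j] by (simp_all add: strand_end_def)
    then show ?thesis using True by (simp add: LL_strands_def not_less[symmetric])
  qed (auto simp: LL_strands_def)
qed

lemma LL_entry_bounds:
  assumes "defining_vector ds" "1 \<le> j" "j \<le> num_over ds - trip_number ds"
  shows "2 \<le> d_at ds j \<and> d_at ds j \<le> trip_number ds"
proof -
  have "num_over ds + 1 - (num_over ds + 1 - j) = j" using assms by simp
  then show ?thesis
    using short_row[OF assms(1), of "num_over ds + 1 - j"] d_at_ge2[OF assms(1), of j] assms trip_number_le[of ds]
    by (auto simp: row_def)
qed

lemma nth_sorted_list_of_set_gt_iff:
  fixes S :: "nat set"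
  assumes "finite S" "k < card S"
  shows "sorted_list_of_set S ! k > p \<longleftrightarrow> card {x \<in> S. x \<le> p} \<le> k"
proof -
  let ?A = "{x \<in> S. x \<le> p}" and ?B = "{x \<in> S. p < x}"
  have S: "S = ?A \<union> ?B" by auto
  have fin: "finite ?A" "finite ?B" using assms(1) by auto
  have "sorted_list_of_set S = sorted_list_of_set ?A @ sorted_list_of_set ?B"
  proof (rule sorted_distinct_set_unique)
    show "sorted (sorted_list_of_set ?A @ sorted_list_of_set ?B)"
      using fin by (auto simp: sorted_append)
    show "distinct (sorted_list_of_set ?A @ sorted_list_of_set ?B)" using fin by auto
    show "set (sorted_list_of_set S) = set (sorted_list_of_set ?A @ sorted_list_of_set ?B)"
      using fin assms(1) by auto
  qed (use assms(1) in auto)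
  moreover have "card S = card ?A + card ?B"
    by (subst S, rule card_Un_disjoint) (use fin in auto)
  moreover have "sorted_list_of_set ?A ! k \<in> ?A" if "k < card ?A"
    using that nth_mem[of k "sorted_list_of_set ?A"] fin by simp
  moreover have "sorted_list_of_set ?B ! (k - card ?A) \<in> ?B" if "card ?A \<le> k" "card S = card ?A + card ?B"
    using that nth_mem[of "k - card ?A" "sorted_list_of_set ?B"] fin assms(2) by simp
  ultimately show ?thesis by (auto simp: nth_append not_less)
qed

text \<open>
  The left end positions not taken by the \<open>p - t\<close> strands of type LL are filled by undercrossing
  strands.
\<close>

lemma under_ends_left_card:
  assumes "defining_vector ds"
  shows "card {x \<in> {1..num_strands ds} - over_ends ds. x \<le> num_over ds} = trip_number ds"
proof -
  let ?p = "num_over ds" and ?t = "trip_number ds"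
  have inj: "inj_on (\<lambda>i. i + d_at ds i) {1..?p}"
    using over_ends_card[OF assms] by (intro eq_card_imp_inj_on) (auto simp: over_ends_def over_strands_def)
  have eq: "over_ends ds \<inter> {1..?p} = (\<lambda>i. i + d_at ds i) ` {1..?p - ?t}"
  proof (intro equalityI subsetI)
    fix k assume "k \<in> over_ends ds \<inter> {1..?p}"
    then obtain i where i: "1 \<le> i" "i \<le> ?p" "k = i + d_at ds i" "k \<le> ?p"
      by (auto simp: over_ends_def over_strands_def)
    then show "k \<in> (\<lambda>i. i + d_at ds i) ` {1..?p - ?t}"
      using strand_crosses_middle_iff[OF assms, of i] by auto
  next
    fix k assume "k \<in> (\<lambda>i. i + d_at ds i) ` {1..?p - ?t}"
    then obtain i where i: "1 \<le> i" "i \<le> ?p - ?t" "k = i + d_at ds i" by auto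
    then have "i \<le> ?p" by simp
    then show "k \<in> over_ends ds \<inter> {1..?p}"
      using i strand_crosses_middle_iff[OF assms, of i] by (auto simp: over_ends_def over_strands_def)
  qed
  have "card (over_ends ds \<inter> {1..?p}) = ?p - ?t"
    unfolding eq by (subst card_image[OF inj_on_subset[OF inj]]) auto
  moreover have "{x \<in> {1..num_strands ds} - over_ends ds. x \<le> ?p} = {1..?p} - over_ends ds \<inter> {1..?p}"
    by (auto simp: num_strands_def)
  ultimately show ?thesis using trip_number_le[of ds] by (simp add: card_Diff_subset)
qed

lemma RR_strands_eq:
  assumes "defining_vector ds"
  shows "RR_strands ds = {num_over ds + trip_number ds + 1..num_strands ds}"
proof -
  let ?p = "num_over ds" and ?N = "num_strands ds" and ?C = "{1..num_strands ds} - over_ends ds"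
  have "?p < strand_end ds j \<longleftrightarrow> ?p + trip_number ds < j" if "?p < j" "j \<le> ?N" for j
  proof -
    have "j - ?p - 1 < card ?C" using that under_ends_card[OF assms] by (simp add: num_strands_def)
    from nth_sorted_list_of_set_gt_iff[OF _ this, of ?p] under_ends_left_card[OF assms]
    show ?thesis using that by (auto simp: strand_end_def over_ends_def)
  qed
  then show ?thesis
    using strand_end_in[OF assms] by (auto simp: RR_strands_def Suc_le_eq) 
qed

text \<open>
  Conjugation of the Young diagram: column \<open>c\<close> reaches row \<open>r\<close> iff row \<open>r\<close> reaches column \<open>c\<close>.
\<close>

lemma le_column_iff:
  assumes "defining_vector ds" "1 \<le> r" "r \<le> num_over ds"
  shows "r \<le> card {i \<in> over_strands ds. c \<le> d_at ds i} \<longleftrightarrow> c \<le> row ds r"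
proof -
  let ?A = "{i \<in> over_strands ds. c \<le> d_at ds i}"
  have "r \<le> card ?A \<longleftrightarrow> num_over ds + 1 - r \<in> ?A"
  proof (rule upper_set_card)
    fix x y assume "x \<in> ?A" "x \<le> y" "y \<le> num_over ds"
    then show "y \<in> ?A" using d_at_mono[OF assms(1), of x y] by (auto simp: over_strands_def)
  qed (use assms in \<open>auto simp: over_strands_def\<close>)
  also have "\<dots> \<longleftrightarrow> c \<le> row ds r" using assms by (auto simp: over_strands_def row_def)
  finally show ?thesis .
qed

text \<open>
  The rows of the Durfee square together with everything to its right, continued by the width of
  the square. Truncating the shorter rows in this way lets the last count \<open>m\<close>, that of the columns of
  height \<open>t\<close>, obey the same difference formula as the others.
\<close>

definition long_part :: "nat list \<Rightarrow> nat \<Rightarrow> nat" where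
  "long_part ds r = (if r \<le> trip_number ds then row ds r else trip_number ds)"

text \<open>
  The columns of height exactly \<open>i + 1\<close> are those that meet row \<open>i + 1\<close> but not row \<open>i + 2\<close>.
\<close>

lemma RR_counts_nth:
  assumes ds: "defining_vector ds" and i: "1 \<le> i" "i < trip_number ds"
  shows "RR_counts ds ! (i - 1) = long_part ds (i + 1) - long_part ds (i + 2)"
proof -
  let ?p = "num_over ds" and ?N = "num_strands ds" and ?t = "trip_number ds"
  let ?h = "\<lambda>c. card {x \<in> over_strands ds. c \<le> d_at ds x}"
  have tp: "?t \<le> ?p" by (rule trip_number_le)
  have le: "?h c \<le> ?p" for c
  proof -
    have "?h c \<le> card {1..?p}" unfolding over_strands_def by (intro card_mono) auto
    then show ?thesis by simp
  qed
  have bar: "d_bar ds (strand_bar ds j) = ?h (j - ?p)" if "?p < j" "j \<le> ?N" for j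
  proof -
    have "num_under ds + 1 - (?N + 1 - j) = j - ?p" using that by (simp add: num_strands_def)
    then show ?thesis by (simp add: d_bar_def strand_bar_def)
  qed
  have height: "?h c = i + 1 \<longleftrightarrow> long_part ds (i + 2) < c \<and> c \<le> long_part ds (i + 1)" if c: "?t < c" for c
  proof -
    have "?h c = i + 1 \<longleftrightarrow> i + 1 \<le> ?h c \<and> \<not> i + 2 \<le> ?h c" by linarith
    also have "i + 1 \<le> ?h c \<longleftrightarrow> c \<le> long_part ds (i + 1)"
      using le_column_iff[OF ds, of "i + 1" c] i tp by (simp add: long_part_def)
    \<comment> \<open>row \<open>i + 2\<close> may lie below the square, or even below the whole diagram\<close>
    also have "i + 2 \<le> ?h c \<longleftrightarrow> c \<le> long_part ds (i + 2)"
    proof (cases "i + 2 \<le> ?p")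
      case True
      then show ?thesis
        using le_column_iff[OF ds, of "i + 2" c] short_row[OF ds, of "i + 2"] c
        by (auto simp: long_part_def)
    next
      case False
      then show ?thesis using le[of c] tp c by (simp add: long_part_def)
    qed
    finally show ?thesis by auto
  qed
  have lower: "?t \<le> long_part ds (i + 2)"
    using long_row[OF ds, of "i + 2"] by (simp add: long_part_def)
  have upper: "long_part ds (i + 1) \<le> num_under ds"
    using row_antimono[OF ds, of 1 "i + 1"] row_1[of ds] i tp by (simp add: long_part_def)
  have "{j \<in> RR_strands ds. d_bar ds (strand_bar ds j) = i + 1}
      = (\<lambda>c. c + ?p) ` {long_part ds (i + 2) + 1..long_part ds (i + 1)}" (is "?L = ?R")
  proof (intro equalityI subsetI)
    fix j assume "j \<in> ?L"
    then have j: "?p + ?t < j" "j \<le> ?N" "d_bar ds (strand_bar ds j) = i + 1"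
      by (simp_all add: RR_strands_eq[OF ds])
    then have "?h (j - ?p) = i + 1" using bar[of j] by simp
    then have "long_part ds (i + 2) < j - ?p \<and> j - ?p \<le> long_part ds (i + 1)"
      using height[of "j - ?p"] j(1) by simp
    then have "j = j - ?p + ?p" "j - ?p \<in> {long_part ds (i + 2) + 1..long_part ds (i + 1)}"
      by auto
    then show "j \<in> ?R" by blast
  next
    fix j assume "j \<in> ?R"
    then obtain c where "j = c + ?p" "c \<in> {long_part ds (i + 2) + 1..long_part ds (i + 1)}" by blast
    then have c: "j = c + ?p" "long_part ds (i + 2) < c" "c \<le> long_part ds (i + 1)" by simp_all
    then have j: "?p + ?t < j" "j \<le> ?N" using lower upper by (simp_all add: num_strands_def)
    have "?h c = i + 1" using height[of c] c lower by simp
    then have "d_bar ds (strand_bar ds j) = i + 1" using bar[of j] j c(1) by simp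
    then show "j \<in> ?L" using j by (simp add: RR_strands_eq[OF ds])
  qed
  then have "card ?L = card {long_part ds (i + 2) + 1..long_part ds (i + 1)}"
    by (simp add: card_image)
  moreover have "[1..<?t] ! (i - 1) = i" using i by (subst nth_upt) auto
  ultimately show ?thesis using i by (simp add: RR_counts_def)
qed

lemma long_part_antimono:
  assumes ds: "defining_vector ds" "1 \<le> r" "r \<le> s"
  shows "long_part ds s \<le> long_part ds r"
  using row_antimono[OF assms] long_row[OF ds(1), of r] trip_number_le[of ds] assms
  by (auto simp: long_part_def)

lemma RR_counts_length [simp]: "length (RR_counts ds) = trip_number ds - 1"
  by (simp add: RR_counts_def)

lemma LL_counts_length [simp]: "length (LL_counts ds) = trip_number ds - 1"
  by (simp add: LL_counts_def)

lemma long_part_eq_sum: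
  assumes ds: "defining_vector ds" and r: "2 \<le> r" "r \<le> trip_number ds + 1"
  shows "long_part ds r = trip_number ds + sum_list (drop (r - 2) (RR_counts ds))"
  using r(2,1)
proof (induction r rule: inc_induct)
  case base
  then show ?case by (simp add: long_part_def)
next
  case (step r)
  define i where "i = r - 1"
  have i: "r = i + 1" "1 \<le> i" using step.prems by (auto simp: i_def)
  have "drop (r - 2) (RR_counts ds) = RR_counts ds ! (i - 1) # drop (Suc r - 2) (RR_counts ds)"
    using step.hyps i Cons_nth_drop_Suc[of "i - 1" "RR_counts ds"] by simp
  then show ?case
    using step i RR_counts_nth[OF ds, of i] long_part_antimono[OF ds, of r "Suc r"] by simp
qed

text \<open>
  For the first row, truncated subtraction gives the same value as for the second row; this is where
  the equality of the last two entries of a defining vector enters.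
\<close>

lemma row_eq_sum:
  assumes ds: "defining_vector ds" and r: "1 \<le> r" "r \<le> trip_number ds"
  shows "row ds r = trip_number ds + sum_list (drop (r - 2) (RR_counts ds))"
proof (cases "r = 1")
  case True
  then show ?thesis
    using long_part_eq_sum[OF ds, of 2] row_1[of ds] row_2[OF ds] trip_number_ge2[OF ds]
    by (simp add: long_part_def)
next
  case False
  then show ?thesis using long_part_eq_sum[OF ds, of r] r by (simp add: long_part_def)
qed

section \<open>Sorted lists and multiplicities\<close>

definition list_of_counts :: "(nat \<Rightarrow> nat) \<Rightarrow> nat \<Rightarrow> nat \<Rightarrow> nat list" where
  "list_of_counts f a b = concat (map (\<lambda>v. replicate (f v) v) [a..<b])"

lemma set_list_of_counts: "set (list_of_counts f a b) \<subseteq> {a..<b}"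
  by (auto simp: list_of_counts_def)

lemma sorted_list_of_counts: "sorted (list_of_counts f a b)"
proof (induction b)
  case (Suc b)
  then show ?case using set_list_of_counts[of f a b]
    by (auto simp: list_of_counts_def sorted_append)
qed (simp add: list_of_counts_def)

lemma count_list_of_counts:
  "count_list (list_of_counts f a b) v = (if a \<le> v \<and> v < b then f v else 0)"
proof (induction b)
  case (Suc b)
  have "count_list (replicate n b) v = (if v = b then n else 0)" for n
    by (induction n) auto
  then show ?case using Suc by (auto simp: list_of_counts_def)
qed (simp add: list_of_counts_def)

lemma sorted_eq_list_of_counts:
  assumes "sorted xs" "set xs \<subseteq> {a..<b}" "\<And>v. a \<le> v \<Longrightarrow> v < b \<Longrightarrow> f v = count_list xs v"
  shows "list_of_counts f a b = xs"
proof -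
  have "count_list xs v = 0" if "\<not> (a \<le> v \<and> v < b)" for v
    using that assms(2) by (auto simp: count_list_0_iff)
  then have "mset (list_of_counts f a b) = mset xs"
    using assms(3) by (intro multiset_eqI) (simp add: count_mset count_list_of_counts)
  then show ?thesis
    using properties_for_sort[OF _ sorted_list_of_counts] properties_for_sort[OF HOL.refl assms(1)] by metis
qed

lemma card_entries_eq_count_list:
  assumes "k \<le> length ds"
  shows "card {j \<in> {1..k}. d_at ds j = v} = count_list (take k ds) v"
proof -
  have "{j \<in> {1..k}. d_at ds j = v} = Suc ` {i. i < length (take k ds) \<and> v = take k ds ! i}"
  proof (intro equalityI subsetI)
    fix j assume "j \<in> {j \<in> {1..k}. d_at ds j = v}"
    then show "j \<in> Suc ` {i. i < length (take k ds) \<and> v = take k ds ! i}"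
      using assms by (cases j) (auto simp: d_at_def)
  qed (use assms in \<open>auto simp: d_at_def\<close>)
  then have "card {j \<in> {1..k}. d_at ds j = v} = card {i. i < length (take k ds) \<and> v = take k ds ! i}"
    by (simp add: card_image)
  then show ?thesis by (simp add: count_list_eq_length_filter length_filter_conv_card)
qed

lemma LL_counts_nth:
  assumes "defining_vector ds" "1 \<le> i" "i < trip_number ds"
  shows "LL_counts ds ! (i - 1) = count_list (take (num_over ds - trip_number ds) ds) (i + 1)"
proof -
  have "[1..<trip_number ds] ! (i - 1) = i" using assms(2,3) by (subst nth_upt) auto
  then show ?thesis
    using card_entries_eq_count_list[of "num_over ds - trip_number ds" ds "i + 1"] assms
    by (simp add: LL_counts_def LL_strands_eq num_over_def)
qed

section \<open>The vector of a triple\<close>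

definition short_entries :: "nat \<Rightarrow> nat list \<Rightarrow> nat list" where
  "short_entries t n = list_of_counts (\<lambda>v. n ! (v - 2)) 2 (t + 1)"

definition long_entries :: "nat \<Rightarrow> nat list \<Rightarrow> nat list" where
  "long_entries t m = map (\<lambda>s. t + sum_list (drop (t - 1 - s) m)) [1..<t + 1]"

text \<open>
  The inverse map: first the rows below the Durfee square, from the bottom up, then the \<open>t\<close> rows
  through the square, whose lengths come from summing the difference formula for \<open>m\<close>.
\<close>

definition vector_of :: "nat \<Rightarrow> nat list \<Rightarrow> nat list \<Rightarrow> nat list" where
  "vector_of t n m = short_entries t n @ long_entries t m"

lemma sorted_defining_vector: "defining_vector ds \<Longrightarrow> sorted ds"
  unfolding sorted_iff_nth_mono_less
proof (intro allI impI)
  fix i j assume "defining_vector ds" "i < j" "j < length ds"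
  then show "ds ! i \<le> ds ! j"
    using d_at_mono[of ds "Suc i" "Suc j"] by (simp add: d_at_def num_over_def)
qed

lemma vector_of_counts:
  assumes ds: "defining_vector ds"
  shows "vector_of (trip_number ds) (LL_counts ds) (RR_counts ds) = ds"
proof -
  let ?p = "num_over ds" and ?t = "trip_number ds"
  have tp: "?t \<le> ?p" by (rule trip_number_le)
  have "short_entries ?t (LL_counts ds) = take (?p - ?t) ds"
    unfolding short_entries_def
  proof (rule sorted_eq_list_of_counts)
    show "sorted (take (?p - ?t) ds)" using sorted_defining_vector[OF ds] by (rule sorted_wrt_take)
    show "set (take (?p - ?t) ds) \<subseteq> {2..<?t + 1}"
    proof
      fix x assume "x \<in> set (take (?p - ?t) ds)"
      then obtain i where "i < ?p - ?t" "x = d_at ds (Suc i)"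
        by (auto simp: in_set_conv_nth d_at_def num_over_def)
      then show "x \<in> {2..<?t + 1}" using LL_entry_bounds[OF ds, of "Suc i"] by auto
    qed
    fix v assume v: "2 \<le> v" "v < ?t + 1"
    then show "LL_counts ds ! (v - 2) = count_list (take (?p - ?t) ds) v"
      using LL_counts_nth[OF ds, of "v - 1"] by (simp add: numeral_2_eq_2)
  qed
  moreover have "long_entries ?t (RR_counts ds) = drop (?p - ?t) ds"
  proof (rule nth_equalityI)
    show len: "length (long_entries ?t (RR_counts ds)) = length (drop (?p - ?t) ds)"
      using tp by (simp add: long_entries_def num_over_def)
    fix i assume "i < length (long_entries ?t (RR_counts ds))"
    then have i: "i < ?t" by (simp add: long_entries_def del: upt_Suc)
    have "drop (?p - ?t) ds ! i = row ds (?t - i)"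
      using i tp by (simp add: row_def d_at_def num_over_def)
    also have "\<dots> = ?t + sum_list (drop (?t - i - 2) (RR_counts ds))"
      using i by (intro row_eq_sum[OF ds]) auto
    finally show "long_entries ?t (RR_counts ds) ! i = drop (?p - ?t) ds ! i"
      using i by (simp add: long_entries_def del: upt_Suc)
  qed
  ultimately show ?thesis by (simp add: vector_of_def)
qed

lemma sum_list_drop_antimono:
  fixes m :: "nat list"
  assumes "i \<le> j"
  shows "sum_list (drop j m) \<le> sum_list (drop i m)"
proof -
  have "drop j m = drop (j - i) (drop i m)" using assms by simp
  moreover have "sum_list (drop k xs) \<le> sum_list xs" for k and xs :: "nat list"
    by (metis append_take_drop_id le_add2 sum_list_append)
  ultimately show ?thesis by metis
qed

context
  fixes t :: nat and n m :: "nat list"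
  assumes triple: "(t, n, m) \<in> lorenz_triples"
begin

abbreviation (input) "vec \<equiv> vector_of t n m"

lemma t_ge2: "2 \<le> t" and length_n: "length n = t - 1" and length_m: "length m = t - 1"
  using triple by (auto simp: lorenz_triples_def)

lemma d_at_append:
  "1 \<le> j \<Longrightarrow> d_at (xs @ ys) j = (if j \<le> length xs then d_at xs j else d_at ys (j - length xs))"
  by (cases j) (auto simp: d_at_def nth_append Suc_le_eq)

lemma num_over_vector_of: "num_over vec = length (short_entries t n) + t"
  by (simp add: num_over_def vector_of_def long_entries_def)

lemma d_at_long:
  assumes "1 \<le> s" "s \<le> t"
  shows "d_at vec (length (short_entries t n) + s) = t + sum_list (drop (t - 1 - s) m)"
proof -
  have "d_at vec (length (short_entries t n) + s) = long_entries t m ! (s - 1)"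
    using assms by (simp add: vector_of_def d_at_append) (simp add: d_at_def)
  also have "\<dots> = t + sum_list (drop (t - 1 - [1..<t + 1] ! (s - 1)) m)"
    unfolding long_entries_def by (rule nth_map) (use assms in auto)
  also have "[1..<t + 1] ! (s - 1) = s" using assms by (subst nth_upt) auto
  finally show ?thesis .
qed

lemma d_at_short:
  assumes "1 \<le> j" "j \<le> length (short_entries t n)"
  shows "2 \<le> d_at vec j \<and> d_at vec j \<le> t"
proof -
  have "j - 1 < length (short_entries t n)" using assms by simp
  then have "short_entries t n ! (j - 1) \<in> {2..<t + 1}"
    using nth_mem set_list_of_counts unfolding short_entries_def by blast
  then show ?thesis using assms by (simp add: vector_of_def d_at_append) (simp add: d_at_def)
qed

lemma row_vector_of:
  assumes "1 \<le> r" "r \<le> t"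
  shows "row vec r = t + sum_list (drop (r - 2) m)"
proof -
  have "num_over vec + 1 - r = length (short_entries t n) + (t + 1 - r)"
    using assms by (simp add: num_over_vector_of)
  moreover have "t - 1 - (t + 1 - r) = r - 2" using assms by simp
  ultimately show ?thesis using d_at_long[of "t + 1 - r"] assms by (simp add: row_def)
qed

lemma defining_vector_vector_of: "defining_vector vec"
proof -
  let ?k = "length (short_entries t n)"
  have mono: "d_at vec i \<le> d_at vec j" if "1 \<le> i" "i \<le> j" "j \<le> num_over vec" for i j
  proof -
    consider "j \<le> ?k" | "i \<le> ?k" "?k < j" | "?k < i" using that by linarith
    then show ?thesis
    proof cases
      case 1
      then have "short_entries t n ! (i - 1) \<le> short_entries t n ! (j - 1)"
        using that sorted_nth_mono[OF sorted_list_of_counts, of "i - 1" "j - 1"]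
        unfolding short_entries_def by simp
      then show ?thesis using 1 that by (simp add: vector_of_def d_at_append) (simp add: d_at_def)
    next
      case 2
      then show ?thesis
        using d_at_short[of i] d_at_long[of "j - ?k"] that by (simp add: num_over_vector_of)
    next
      case 3
      then show ?thesis
        using d_at_long[of "i - ?k"] d_at_long[of "j - ?k"] that
          sum_list_drop_antimono[of "t - 1 - (j - ?k)" "t - 1 - (i - ?k)" m]
        by (simp add: num_over_vector_of)
    qed
  qed
  have "2 \<le> num_over vec" using t_ge2 by (simp add: num_over_vector_of)
  moreover have "2 \<le> d_at vec 1"
    using t_ge2 d_at_short[of 1] d_at_long[of 1] by (cases "?k = 0") auto
  moreover have "d_at vec (num_over vec - 1) = d_at vec (num_over vec)"
    using row_vector_of[of 1] row_vector_of[of 2] t_ge2 by (simp add: row_def numeral_2_eq_2)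
  ultimately show ?thesis using mono by (simp add: defining_vector_def)
qed

lemma trip_number_vector_of: "trip_number vec = t"
proof (rule antisym)
  note iff = le_trip_number_iff[OF defining_vector_vector_of]
  show "t \<le> trip_number vec"
    using iff[of t] row_vector_of[of t] t_ge2 by (simp add: num_over_vector_of)
  show "trip_number vec \<le> t"
  proof (rule ccontr)
    assume "\<not> ?thesis"
    then have *: "t + 1 \<le> trip_number vec" by simp
    then have "t + 1 \<le> num_over vec" using trip_number_le[of vec] by simp
    moreover from this have "row vec (t + 1) \<le> t"
      using d_at_short[of "num_over vec - t"] by (simp add: row_def num_over_vector_of)
    ultimately show False using iff[of "t + 1"] * by simp
  qed
qed

lemma LL_counts_vector_of: "LL_counts vec = n"
proof (rule nth_equalityI)
  show "length (LL_counts vec) = length n" by (simp add: trip_number_vector_of length_n)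
  fix i assume "i < length (LL_counts vec)"
  then have i: "i < t - 1" by (simp add: trip_number_vector_of)
  have "LL_counts vec ! i = count_list (take (num_over vec - t) vec) (i + 2)"
    using LL_counts_nth[OF defining_vector_vector_of, of "i + 1"] i by (simp add: trip_number_vector_of)
  also have "take (num_over vec - t) vec = short_entries t n"
    by (simp add: num_over_vector_of) (simp add: vector_of_def)
  finally show "LL_counts vec ! i = n ! i"
    using i by (auto simp: short_entries_def count_list_of_counts)
qed

lemma RR_counts_vector_of: "RR_counts vec = m"
proof (rule nth_equalityI)
  show "length (RR_counts vec) = length m" by (simp add: trip_number_vector_of length_m)
  fix i assume "i < length (RR_counts vec)"
  then have i: "i < t - 1" by (simp add: trip_number_vector_of)
  have long: "long_part vec r = t + sum_list (drop (r - 2) m)" if "2 \<le> r" "r \<le> t + 1" for r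
    using that row_vector_of[of r] length_m by (auto simp: long_part_def trip_number_vector_of)
  have "RR_counts vec ! i = long_part vec (i + 2) - long_part vec (i + 3)"
    using RR_counts_nth[OF defining_vector_vector_of, of "i + 1"] i
    by (simp add: trip_number_vector_of numeral_3_eq_3)
  also have "\<dots> = sum_list (drop i m) - sum_list (drop (Suc i) m)"
    using i by (simp add: long)
  also have "\<dots> = m ! i" using i length_m by (simp add: Cons_nth_drop_Suc[symmetric])
  finally show "RR_counts vec ! i = m ! i" .
qed

end

lemma counts_bij:
  "bij_betw (\<lambda>ds. (trip_number ds, LL_counts ds, RR_counts ds)) (Collect defining_vector) lorenz_triples"
proof (rule bij_betwI[where g = "\<lambda>(t, n, m). vector_of t n m"])
  show "(\<lambda>ds. (trip_number ds, LL_counts ds, RR_counts ds)) \<in> Collect defining_vector \<rightarrow> lorenz_triples"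
    using trip_number_ge2 by (auto simp: lorenz_triples_def)
  show "(\<lambda>(t, n, m). vector_of t n m) \<in> lorenz_triples \<rightarrow> Collect defining_vector"
    using defining_vector_vector_of by auto
  show "(case (trip_number ds, LL_counts ds, RR_counts ds) of (t, n, m) \<Rightarrow> vector_of t n m) = ds"
    if "ds \<in> Collect defining_vector" for ds
    using that vector_of_counts by simp
  show "(trip_number (case x of (t, n, m) \<Rightarrow> vector_of t n m), LL_counts (case x of (t, n, m) \<Rightarrow> vector_of t n m),
      RR_counts (case x of (t, n, m) \<Rightarrow> vector_of t n m)) = x" if "x \<in> lorenz_triples" for x
    using that trip_number_vector_of LL_counts_vector_of RR_counts_vector_of by (cases x) auto
qed

section \<open>Vectors, braids and triples\<close>

definition lorenz_braid_of :: "nat list \<Rightarrow> nat \<times> braid_word set" where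
  "lorenz_braid_of ds = (num_strands ds, THE \<beta>. is_lorenz_braid ds \<beta>)"

lemma lorenz_braid_of_eq_iff:
  assumes "defining_vector ds"
  shows "lorenz_braid_of ds = (N, \<beta>) \<longleftrightarrow> N = num_strands ds \<and> is_lorenz_braid ds \<beta>"
proof -
  have "\<exists>!\<beta>. is_lorenz_braid ds \<beta>"
    using lorenz_word_exists[OF assms] lorenz_braid_unique[OF assms]
    unfolding is_lorenz_braid_def by blast
  then have "(THE \<beta>. is_lorenz_braid ds \<beta>) = \<beta> \<longleftrightarrow> is_lorenz_braid ds \<beta>"
    by (metis theI')
  then show ?thesis by (auto simp: lorenz_braid_of_def)
qed

lemma lorenz_braid_of_bij: "bij_betw lorenz_braid_of (Collect defining_vector) lorenz_braids"
proof (rule bij_betw_imageI)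
  show "inj_on lorenz_braid_of (Collect defining_vector)"
  proof (rule inj_onI)
    fix ds es assume ds: "ds \<in> Collect defining_vector" and es: "es \<in> Collect defining_vector"
      and eq: "lorenz_braid_of ds = lorenz_braid_of es"
    obtain N \<beta> where "lorenz_braid_of ds = (N, \<beta>)" by fastforce
    then show "ds = es"
      using ds es eq lorenz_braid_of_eq_iff lorenz_braid_determines_vector
      by (metis mem_Collect_eq)
  qed
  show "lorenz_braid_of ` Collect defining_vector = lorenz_braids"
  proof (intro equalityI subsetI)
    fix x assume "x \<in> lorenz_braid_of ` Collect defining_vector"
    then obtain ds where "defining_vector ds" "lorenz_braid_of ds = x" by blast
    then show "x \<in> lorenz_braids"
      using lorenz_braid_of_eq_iff by (cases x) (auto simp: lorenz_braids_def)
  next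
    fix x assume "x \<in> lorenz_braids"
    then obtain ds where "defining_vector ds" "lorenz_braid_of ds = x"
      using lorenz_braid_of_eq_iff by (auto simp: lorenz_braids_def)
    then show "x \<in> lorenz_braid_of ` Collect defining_vector" by blast
  qed
qed

lemma ordered_prod_closed:
  assumes "monoid G" "set xs \<subseteq> carrier G"
  shows "ordered_prod G xs \<in> carrier G"
  using assms(2) by (induction xs) (simp_all add: ordered_prod_def monoid.m_closed[OF assms(1)] monoid.one_closed[OF assms(1)])

lemma sigma_closed: "1 \<le> i \<Longrightarrow> i < n \<Longrightarrow> sigma n i \<in> carrier (braid_group n)"
  by (auto simp: sigma_def braid_group_def braid_words_def)

lemma t_braid_closed: "t_braid t n m \<in> carrier (braid_group t)"
proof -
  interpret group "braid_group t" by (rule braid_group_group)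
  note closed = ordered_prod_closed[OF is_monoid]
  show ?thesis
    unfolding t_braid_def Let_def
    by (intro m_closed nat_pow_closed closed) (auto intro!: nat_pow_closed closed sigma_closed simp: Suc_le_eq)
qed

theorem theorem2:
  shows "(\<exists>\<Phi> :: nat \<times> braid_word set \<Rightarrow> nat \<times> nat list \<times> nat list.
            bij_betw \<Phi> lorenz_braids lorenz_triples \<and>
            (\<forall>ds \<beta>. defining_vector ds \<longrightarrow> is_lorenz_braid ds \<beta> \<longrightarrow>
               \<Phi> (num_strands ds, \<beta>) = (trip_number ds, LL_counts ds, RR_counts ds)))
         \<and> (\<forall>(t, n, m) \<in> lorenz_triples. t_braid t n m \<in> carrier (braid_group t))"
proof -
  let ?V = "Collect defining_vector"
  let ?counts = "\<lambda>ds. (trip_number ds, LL_counts ds, RR_counts ds)"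
  let ?\<Phi> = "?counts \<circ> inv_into ?V lorenz_braid_of"
  have "bij_betw ?\<Phi> lorenz_braids lorenz_triples"
    by (rule bij_betw_trans[OF bij_betw_inv_into[OF lorenz_braid_of_bij] counts_bij])
  moreover have "?\<Phi> (num_strands ds, \<beta>) = ?counts ds"
    if "defining_vector ds" "is_lorenz_braid ds \<beta>" for ds \<beta>
  proof -
    have "lorenz_braid_of ds = (num_strands ds, \<beta>)"
      using that lorenz_braid_of_eq_iff by blast
    then have "inv_into ?V lorenz_braid_of (num_strands ds, \<beta>) = ds"
      using inv_into_f_f[OF bij_betw_imp_inj_on[OF lorenz_braid_of_bij]] that(1) by force
    then show ?thesis by simp
  qed
  ultimately show ?thesis using t_braid_closed by blast
qed

end
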